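(* Let $(\mathcal{C},F)$ be a generalized network code. Then $d_1^{\min}\ge\left\lfloor\frac{d_0^{\min}}{2}\right\rfloor+1$.
   Context: A generalized network channel consists of a set $\mathcal{C}$ of codewords, a set $\mathcal{E}$ of errors with a distinguished element $0$ (the zero error), an output set $\mathcal{Y}$, a weight $w:\mathcal{E}\to\mathbb{Z}_{\ge 0}$ with $w(z)=0$ if and only if $z=0$, and a transfer function $F:\mathcal{C}\times\mathcal{E}\to\mathcal{Y}$ such that $F(x,0)\ne F(x',0)$ whenever $x\neq x'$ in $\mathcal{C}$. The sets are otherwise arbitrary. The pair $(\mathcal{C},F)$ is called a generalized network code; $|\mathcal{C}|\ge 2$ is assumed. For $x\in\mathcal{C}$ and an integer $c\ge 0$, the decoding ball is $\Phi(x,c)=\{F(x,z): z\in\mathcal{E},\ w(z)\le c\}$. For $x_1,x_2\in\mathcal{C}$ (all $c$'s are nonnegative integers, and a minimum over the empty set is $+\infty$, with $\lfloor+\infty/2\rfloor=+\infty$): $D_0(x_1,x_2)=\min\{c_1+c_2 : |c_1-c_2|\le 1,\ \Phi(x_1,c_1)\cap\Phi(x_2,c_2)\ne\emptyset\}$; $D_1(x_1,x_2)=\min\{c : \Phi(x_1,0)\cap\Phi(x_2,c)\neq\emptyset\}$; and $d_i^{\min}=\min_{x_1,x_2\in\mathcal{C},\,x_1\ne x_2}D_i(x_1,x_2)$ for $i=0,1$. *)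

theory Defs
  imports Main "HOL-Library.Extended_Nat"
begin

text \<open>The codeword set, error set and output set are arbitrary carrier sets; \<open>e0\<close> is the zero error.
  Only the values of \<open>w\<close> on \<open>\<E>\<close> and of \<open>F\<close> on \<open>\<C> \<times> \<E>\<close> are constrained.\<close>

locale generalized_network_channel =
  fixes \<C> :: "'x set" and \<E> :: "'e set" and \<Y> :: "'y set"
    and e0 :: 'e and w :: "'e \<Rightarrow> nat" and F :: "'x \<Rightarrow> 'e \<Rightarrow> 'y"
  assumes zero_error_in: "e0 \<in> \<E>"
    and weight_eq_0_iff: "z \<in> \<E> \<Longrightarrow> w z = 0 \<longleftrightarrow> z = e0"
    and transfer_in: "x \<in> \<C> \<Longrightarrow> z \<in> \<E> \<Longrightarrow> F x z \<in> \<Y>"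
    and transfer_zero_neq: "x \<in> \<C> \<Longrightarrow> x' \<in> \<C> \<Longrightarrow> x \<noteq> x' \<Longrightarrow> F x e0 \<noteq> F x' e0"

text \<open>The code may be infinite, so \<open>|\<C>| \<ge> 2\<close> is not expressed through \<^const>\<open>card\<close>,
  which is 0 on infinite sets.\<close>

locale generalized_network_code = generalized_network_channel +
  assumes two_codewords: "\<exists>x\<in>\<C>. \<exists>x'\<in>\<C>. x \<noteq> x'"

definition decoding_ball :: "'e set \<Rightarrow> ('e \<Rightarrow> nat) \<Rightarrow> ('x \<Rightarrow> 'e \<Rightarrow> 'y) \<Rightarrow> 'x \<Rightarrow> nat \<Rightarrow> 'y set"
  where "decoding_ball \<E> w F x c = {F x z | z. z \<in> \<E> \<and> w z \<le> c}"

text \<open>Minima are infima in \<^typ>\<open>enat\<close>: these are attained on nonempty sets, since \<^typ>\<open>enat\<close> is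
  well-ordered, and equal \<open>\<infinity>\<close> on the empty set.\<close>

definition D0 :: "'e set \<Rightarrow> ('e \<Rightarrow> nat) \<Rightarrow> ('x \<Rightarrow> 'e \<Rightarrow> 'y) \<Rightarrow> 'x \<Rightarrow> 'x \<Rightarrow> enat"
  where "D0 \<E> w F x1 x2 =
    Inf {enat (c1 + c2) | c1 c2. \<bar>int c1 - int c2\<bar> \<le> 1 \<and>
           decoding_ball \<E> w F x1 c1 \<inter> decoding_ball \<E> w F x2 c2 \<noteq> {}}"

definition D1 :: "'e set \<Rightarrow> ('e \<Rightarrow> nat) \<Rightarrow> ('x \<Rightarrow> 'e \<Rightarrow> 'y) \<Rightarrow> 'x \<Rightarrow> 'x \<Rightarrow> enat"
  where "D1 \<E> w F x1 x2 =
    Inf {enat c | c. decoding_ball \<E> w F x1 0 \<inter> decoding_ball \<E> w F x2 c \<noteq> {}}"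

definition min_dist :: "'x set \<Rightarrow> ('x \<Rightarrow> 'x \<Rightarrow> enat) \<Rightarrow> enat"
  where "min_dist \<C> D = Inf {D x1 x2 | x1 x2. x1 \<in> \<C> \<and> x2 \<in> \<C> \<and> x1 \<noteq> x2}"

definition d0_min :: "'x set \<Rightarrow> 'e set \<Rightarrow> ('e \<Rightarrow> nat) \<Rightarrow> ('x \<Rightarrow> 'e \<Rightarrow> 'y) \<Rightarrow> enat"
  where "d0_min \<C> \<E> w F = min_dist \<C> (D0 \<E> w F)"

definition d1_min :: "'x set \<Rightarrow> 'e set \<Rightarrow> ('e \<Rightarrow> nat) \<Rightarrow> ('x \<Rightarrow> 'e \<Rightarrow> 'y) \<Rightarrow> enat"
  where "d1_min \<C> \<E> w F = min_dist \<C> (D1 \<E> w F)"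

text \<open>\<open>\<lfloor>n / 2\<rfloor>\<close>, with \<open>\<lfloor>\<infinity> / 2\<rfloor> = \<infinity>\<close>.\<close>

definition floor_half :: "enat \<Rightarrow> enat"
  where "floor_half n = (case n of enat k \<Rightarrow> enat (k div 2) | \<infinity> \<Rightarrow> \<infinity>)"

end

theory Submission
  imports Defs
begin

text \<open>If \<open>\<Phi>(x\<^sub>1, 0)\<close> meets \<open>\<Phi>(x\<^sub>2, c)\<close> for distinct codewords, then \<open>c \<ge> 1\<close> because \<open>F(\<cdot>, 0)\<close> is
  injective. Enlarging the first ball to radius \<open>c - 1\<close> makes the pair of radii admissible for
  \<open>D\<^sub>0\<close>, so \<open>d\<^sub>0 \<le> 2c - 1\<close>, that is, \<open>\<lfloor>d\<^sub>0 / 2\<rfloor> + 1 \<le> c\<close>.\<close>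

lemma decoding_ball_mono:
  assumes "c \<le> c'"
  shows "decoding_ball \<E> w F x c \<subseteq> decoding_ball \<E> w F x c'"
  using assms by (auto simp: decoding_ball_def)

lemma (in generalized_network_channel) decoding_ball_0: "decoding_ball \<E> w F x 0 = {F x e0}"
  using zero_error_in weight_eq_0_iff by (auto simp: decoding_ball_def)

lemma D0_le:
  assumes "\<bar>int c1 - int c2\<bar> \<le> 1"
    and "decoding_ball \<E> w F x1 c1 \<inter> decoding_ball \<E> w F x2 c2 \<noteq> {}"
  shows "D0 \<E> w F x1 x2 \<le> enat (c1 + c2)"
  unfolding D0_def using assms by (intro Inf_lower) blast

text \<open>The bound is odd, so halving rounds it down to \<open>k\<close>, which leaves room for
  the \<open>+ 1\<close>.\<close>

lemma floor_half_Suc_le: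
  assumes "n \<le> enat (Suc (2 * k))"
  shows "floor_half n + 1 \<le> enat (Suc k)"
  using assms by (cases n) (auto simp: floor_half_def one_enat_def)

lemma (in generalized_network_channel) floor_half_le_radius:
  assumes "x1 \<in> \<C>" "x2 \<in> \<C>" "x1 \<noteq> x2"
    and meet: "decoding_ball \<E> w F x1 0 \<inter> decoding_ball \<E> w F x2 c \<noteq> {}"
  shows "floor_half (d0_min \<C> \<E> w F) + 1 \<le> enat c"
proof (cases c)
  case 0
  \<comment> \<open>Vacuous: balls of radius 0 are singletons \<open>{F x e0}\<close>, disjoint for
    distinct codewords.\<close>
  then show ?thesis
    using meet transfer_zero_neq[OF assms(1-3)] by (simp add: decoding_ball_0)
next
  case (Suc k)
  \<comment> \<open>\<open>k\<close> is the least radius within 1 of \<open>Suc k\<close>, so it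
    gives the smallest sum.\<close>
  have "decoding_ball \<E> w F x1 k \<inter> decoding_ball \<E> w F x2 (Suc k) \<noteq> {}"
    using meet decoding_ball_mono[of 0 k \<E> w F x1] Suc by blast
  then have "D0 \<E> w F x1 x2 \<le> enat (k + Suc k)"
    by (intro D0_le) auto
  moreover have "d0_min \<C> \<E> w F \<le> D0 \<E> w F x1 x2"
    unfolding d0_min_def min_dist_def using assms(1-3) by (intro Inf_lower) blast
  ultimately have "d0_min \<C> \<E> w F \<le> enat (Suc (2 * k))"
    by (simp add: mult_2)
  then show ?thesis
    unfolding Suc by (rule floor_half_Suc_le)
qed

theorem corollary4p9:
  fixes \<C> :: "'x set" and \<E> :: "'e set" and \<Y> :: "'y set"
    and e0 :: 'e and w :: "'e \<Rightarrow> nat" and F :: "'x \<Rightarrow> 'e \<Rightarrow> 'y"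
  assumes "generalized_network_code \<C> \<E> \<Y> e0 w F"
  shows "d1_min \<C> \<E> w F \<ge> floor_half (d0_min \<C> \<E> w F) + 1"
proof -
  interpret generalized_network_code \<C> \<E> \<Y> e0 w F
    by (rule assms)
  show ?thesis
    unfolding d1_min_def min_dist_def D1_def
    \<comment> \<open>The outer infimum runs over codeword pairs, the inner one over radii; an empty
      set of radii (value \<infinity>) needs no separate case.\<close>
    by (rule Inf_greatest, clarify, rule Inf_greatest, clarify, rule floor_half_le_radius)
qed

end
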